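(* Let $(M,d)$ be a complete pointed metric space, let $E\subset\mathcal{R}(M)$ be Borel and closed with respect to $\bar{d}$, and let $i\in\{1,2\}$. Then $\mathcal{R}\cap p_i^{-1}(E)$ belongs to $\mathfrak{C}$; that is, whenever $\mu,\nu$ are positive Radon measures on $\beta\widetilde{M}$ with $\mu\preccurlyeq\nu$ and $\nu$ concentrated on $\mathcal{R}\cap p_i^{-1}(E)$, then $\mu$ is concentrated on $\mathcal{R}\cap p_i^{-1}(E)$.
   Context: $\mathrm{Lip}_0(M)$: Lipschitz $f:M\to\mathbb{R}$ with $f(0)=0$ ($0$ the base point), normed by the Lipschitz constant. $\widetilde{M}=\{(x,y)\in M\times M:x\ne y\}$, $\beta\widetilde{M}$ its Stone–Čech compactification; Radon measures identified with $C(\beta\widetilde{M})^*$. $M^u$ is the uniform (Samuel) compactification of $M$; $p_1,p_2:\beta\widetilde{M}\to M^u$ continuously extend the coordinate projections, $p=(p_1,p_2)$. $\mathcal{R}(M)=\{\xi\in M^u:\overline{d_0}(\xi)<\infty\}$, where $\overline{d_0}:M^u\to[0,\infty]$ continuously extends $x\mapsto d(x,0)$, with the subspace topology; every $f\in\mathrm{Lip}_0(M)$ extends uniquely to a continuous $f^{\mathcal{R}}:\mathcal{R}(M)\to\mathbb{R}$, and $\bar d(\xi,\eta)=\sup\{|f^{\mathcal{R}}(\xi)-f^{\mathcal{R}}(\eta)|: f\in\mathrm{Lip}_0(M),\ \mathrm{Lip}(f)\le1\}$ is a metric on $\mathcal{R}(M)$ extending $d$; "Borel" refers to the topology of $\mathcal{R}(M)$.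 $\mathcal{R}=p^{-1}(\mathcal{R}(M)\times\mathcal{R}(M))$. $G$ is the set of $g\in C(\beta\widetilde{M})$ with $d(x,y)g(x,y)\le d(x,u)g(x,u)+d(u,y)g(u,y)$ for all distinct $x,u,y\in M$; $\mu\preccurlyeq\nu$ iff $\int g\,d\mu\le\int g\,d\nu$ for all $g\in G$. $\mathfrak{C}$ is the family of Borel $C\subset\beta\widetilde{M}$ such that for positive $\mu,\nu$ with $\mu\preccurlyeq\nu$ and $\nu$ concentrated on $C$, $\mu$ is concentrated on $C$. Throughout, $M$ has at least three distinct points. *)

theory Defs
  imports "HOL-Analysis.Analysis"
begin

definition borel_of :: "'a topology \<Rightarrow> 'a measure" where
  "borel_of X = sigma (topspace X) {U. openin X U}"

definition Mtil :: "('a \<times> 'a) set" where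
  "Mtil = {(x, y). x \<noteq> y}"

text \<open>Bounded continuous real functions on \<open>M~\<close>: these index the standard
  embedding of the Tychonoff space \<open>M~\<close> into a cube; the closure of the image
  is the Stone-Cech compactification.\<close>
definition Cb_til :: "('a::metric_space \<times> 'a \<Rightarrow> real) set" where
  "Cb_til = {f. continuous_on Mtil f \<and> bounded (f ` Mtil)}"

definition evB :: "'a::metric_space \<times> 'a \<Rightarrow> (('a \<times> 'a \<Rightarrow> real) \<Rightarrow> real)" where
  "evB q = restrict (\<lambda>f. f q) Cb_til"

definition betaM :: "(('a::metric_space \<times> 'a \<Rightarrow> real) \<Rightarrow> real) set" where
  "betaM = (powertop_real Cb_til) closure_of (evB ` Mtil)"

definition betaTop :: "(('a::metric_space \<times> 'a \<Rightarrow> real) \<Rightarrow> real) topology" where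
  "betaTop = subtopology (powertop_real Cb_til) betaM"

text \<open>Bounded uniformly continuous real functions on \<open>M\<close>; the closure of the
  evaluation image is the uniform (Samuel) compactification \<open>M^u\<close>.\<close>
definition Ub :: "('a::metric_space \<Rightarrow> real) set" where
  "Ub = {f. uniformly_continuous_on UNIV f \<and> bounded (range f)}"

definition evU :: "'a::metric_space \<Rightarrow> (('a \<Rightarrow> real) \<Rightarrow> real)" where
  "evU x = restrict (\<lambda>f. f x) Ub"

definition Mu :: "(('a::metric_space \<Rightarrow> real) \<Rightarrow> real) set" where
  "Mu = (powertop_real Ub) closure_of (range evU)"

definition MuTop :: "(('a::metric_space \<Rightarrow> real) \<Rightarrow> real) topology" where
  "MuTop = subtopology (powertop_real Ub) Mu"

text \<open>The continuous extensions \<open>p_1, p_2 : \<beta>M~ \<rightarrow> M^u\<close> of the coordinate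
  projections (written out explicitly in this model: \<open>p_i \<xi> (f) = \<xi> (f \<circ> \<pi>_i)\<close>).\<close>
definition pext :: "nat \<Rightarrow> (('a::metric_space \<times> 'a \<Rightarrow> real) \<Rightarrow> real) \<Rightarrow> (('a \<Rightarrow> real) \<Rightarrow> real)" where
  "pext i \<xi> = restrict (\<lambda>f. \<xi> (\<lambda>q. f (if i = 1 then fst q else snd q))) Ub"

text \<open>Continuous extension \<open>M^u \<rightarrow> [0,\<infinity>]\<close> of \<open>x \<mapsto> d(x,0)\<close>, written as the
  supremum of the extensions of the truncations \<open>min(d(\<cdot>,0), n)\<close>.\<close>
definition d0bar :: "'a::metric_space \<Rightarrow> (('a \<Rightarrow> real) \<Rightarrow> real) \<Rightarrow> ereal" where
  "d0bar x0 \<xi> = (SUP n::nat. ereal (\<xi> (\<lambda>x. min (dist x x0) (real n))))"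

definition RM :: "'a::metric_space \<Rightarrow> (('a \<Rightarrow> real) \<Rightarrow> real) set" where
  "RM x0 = {\<xi> \<in> Mu. d0bar x0 \<xi> < \<infinity>}"

definition RMTop :: "'a::metric_space \<Rightarrow> (('a \<Rightarrow> real) \<Rightarrow> real) topology" where
  "RMTop x0 = subtopology MuTop (RM x0)"

definition Lip0 :: "'a::metric_space \<Rightarrow> ('a \<Rightarrow> real) set" where
  "Lip0 x0 = {f. f x0 = 0 \<and> (\<exists>L. \<forall>x y. \<bar>f x - f y\<bar> \<le> L * dist x y)}"

definition Lip0_ball :: "'a::metric_space \<Rightarrow> ('a \<Rightarrow> real) set" where
  "Lip0_ball x0 = {f \<in> Lip0 x0. \<forall>x y. \<bar>f x - f y\<bar> \<le> dist x y}"

text \<open>The continuous extension \<open>f^R\<close> of \<open>f \<in> Lip_0(M)\<close> to \<open>R(M)\<close>, via the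
  (eventually constant) extensions of the truncations of \<open>f\<close> at level \<open>n\<close>.\<close>
definition fR :: "('a::metric_space \<Rightarrow> real) \<Rightarrow> (('a \<Rightarrow> real) \<Rightarrow> real) \<Rightarrow> real" where
  "fR f \<xi> = lim (\<lambda>n::nat. \<xi> (\<lambda>x. max (- real n) (min (real n) (f x))))"

definition dbar :: "'a::metric_space \<Rightarrow> (('a \<Rightarrow> real) \<Rightarrow> real) \<Rightarrow> (('a \<Rightarrow> real) \<Rightarrow> real) \<Rightarrow> real" where
  "dbar x0 \<xi> \<eta> = (SUP f \<in> Lip0_ball x0. \<bar>fR f \<xi> - fR f \<eta>\<bar>)"

definition radon_pos :: "'b topology \<Rightarrow> 'b measure \<Rightarrow> bool" where
  "radon_pos X \<mu> \<longleftrightarrow> space \<mu> = topspace X \<and> sets \<mu> = sets (borel_of X) \<and>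
     finite_measure \<mu> \<and>
     (\<forall>B \<in> sets \<mu>. emeasure \<mu> B = (SUP K \<in> {K. compactin X K \<and> K \<subseteq> B}. emeasure \<mu> K))"

definition Gcone :: "(((('a::metric_space \<times> 'a \<Rightarrow> real) \<Rightarrow> real)) \<Rightarrow> real) set" where
  "Gcone = {g. continuous_map betaTop euclideanreal g \<and>
     (\<forall>x u y. x \<noteq> u \<and> x \<noteq> y \<and> u \<noteq> y \<longrightarrow>
        dist x y * g (evB (x, y)) \<le> dist x u * g (evB (x, u)) + dist u y * g (evB (u, y)))}"

definition preceq :: "(('a::metric_space \<times> 'a \<Rightarrow> real) \<Rightarrow> real) measure \<Rightarrow> (('a \<times> 'a \<Rightarrow> real) \<Rightarrow> real) measure \<Rightarrow> bool" where
  "preceq \<mu> \<nu> \<longleftrightarrow> (\<forall>g \<in> Gcone. integral\<^sup>L \<mu> g \<le> integral\<^sup>L \<nu> g)"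

definition concentrated_on :: "'b measure \<Rightarrow> 'b set \<Rightarrow> bool" where
  "concentrated_on \<mu> C \<longleftrightarrow> emeasure \<mu> (space \<mu> - C) = 0"

definition RcapP :: "'a::metric_space \<Rightarrow> nat \<Rightarrow> (('a \<Rightarrow> real) \<Rightarrow> real) set \<Rightarrow> (('a \<times> 'a \<Rightarrow> real) \<Rightarrow> real) set" where
  "RcapP x0 i E = {\<xi> \<in> betaM. pext 1 \<xi> \<in> RM x0 \<and> pext 2 \<xi> \<in> RM x0 \<and> pext i \<xi> \<in> E}"

end

theory Submission
  imports Defs
begin

text \<open>
  For a 1-Lipschitz \<open>h \<ge> 0\<close> on \<open>M\<close> the function \<open>min (d x y) (h x)\<close> obeys the triangle inequality
  in \<open>(x, y)\<close>, and so does \<open>min (d x y) (h y)\<close>. Hence \<open>min 1 (h / d)\<close>, with \<open>h\<close> evaluated at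
  either coordinate, extends to a member of the cone \<open>G\<close> with values in \<open>[0, 1]\<close>. If it vanishes on
  \<open>K\<close> and is at least \<open>c\<close> on \<open>A\<close>, then \<open>\<mu> \<preceq> \<nu>\<close> yields \<open>c \<mu>(A) \<le> \<nu>(K\<^sup>c)\<close>.

  Taking \<open>h = (d(\<cdot>, 0) - N)\<^sup>+\<close> in both coordinates and \<open>K\<close> compact in \<open>\<R>\<close> shows that \<open>\<mu>\<close> does not
  charge the complement of \<open>\<R>\<close>: one of \<open>d(x, 0)\<close>, \<open>d(y, 0)\<close> is at least \<open>d(x, y) / 2\<close>. Inside
  \<open>\<R>\<close>, choose compact sets \<open>K\<^sub>n\<close> in \<open>\<R> \<inter> p\<^sub>i\<^sup>-\<^sup>1(E)\<close> with \<open>\<nu>(K\<^sub>n\<^sup>c) \<rightarrow> 0\<close>. As \<open>E\<close> is closed for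
  the metric of \<open>\<R>(M)\<close>, a point \<open>\<xi>\<close> with \<open>p\<^sub>i(\<xi>) \<notin> E\<close> is separated from all \<open>K\<^sub>n\<close> by 1-Lipschitz
  functions vanishing on \<open>p\<^sub>i(K\<^sub>n)\<close> whose values at \<open>p\<^sub>i(\<xi>)\<close> exceed a bound independent of \<open>n\<close>. Such
  \<open>\<xi>\<close> lie in countably many Borel sets, and the estimate above makes each of them \<open>\<mu>\<close>-null.
\<close>

section \<open>Test functions, evaluations and the projections to the Samuel
  compactification\<close>

definition coord :: "nat \<Rightarrow> 'a \<times> 'a \<Rightarrow> 'a" where
  "coord i q = (if i = 1 then fst q else snd q)"

definition Lip_unit :: "('a::metric_space \<Rightarrow> real) set" where
  "Lip_unit = {h. (\<forall>x. 0 \<le> h x \<and> h x \<le> 1) \<and> (\<forall>x y. \<bar>h x - h y\<bar> \<le> dist x y)}"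

text \<open>For \<open>h \<ge> 0\<close> the truncation at 1 keeps the quotient bounded where
  \<open>dist\<close> tends to 0, so that points of \<open>betaM\<close> can be evaluated at
  it.\<close>

definition slope :: "nat \<Rightarrow> ('a::metric_space \<Rightarrow> real) \<Rightarrow> 'a \<times> 'a \<Rightarrow> real" where
  "slope i h q = min 1 (h (coord i q) / dist (fst q) (snd q))"

text \<open>A basic open set of the product restricts only finitely many coordinates. Pointwise
  relations between finitely many functions therefore pass, up to arbitrarily small errors, to
  points of either compactification.\<close>

lemma closure_powertop_approx:
  assumes \<xi>: "\<xi> \<in> powertop_real I closure_of ((\<lambda>q. restrict (\<lambda>f. f q) I) ` S)"
    and A: "finite A" "A \<subseteq> I" and e: "e > 0"
  obtains q where "q \<in> S" "\<forall>f\<in>A. \<bar>f q - \<xi> f\<bar> < e"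
proof -
  let ?U = "\<lambda>f. if f \<in> A then ball (\<xi> f) e else UNIV"
  have ext: "\<xi> \<in> PiE I (\<lambda>_. UNIV)"
    using \<xi> closure_of_subset_topspace by fastforce
  have "openin (powertop_real I) (PiE I ?U)"
    by (rule product_topology_basis) (auto intro: finite_subset[OF _ A(1)])
  moreover have "\<xi> \<in> PiE I ?U"
    using ext e by (auto simp: PiE_iff)
  ultimately obtain y where y: "y \<in> (\<lambda>q. restrict (\<lambda>f. f q) I) ` S" "y \<in> PiE I ?U"
    using \<xi> unfolding in_closure_of by blast
  then obtain q where q: "q \<in> S" "y = restrict (\<lambda>f. f q) I" by auto
  have "\<bar>f q - \<xi> f\<bar> < e" if "f \<in> A" for f
  proof -
    have "f \<in> I" using that A by auto
    then have "y f \<in> ball (\<xi> f) e" using y(2) that by (auto simp: PiE_iff)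
    then show ?thesis using q(2) \<open>f \<in> I\<close> by (simp add: dist_real_def abs_minus_commute)
  qed
  with q(1) that show ?thesis by blast
qed

lemma Mu_approx:
  assumes "\<xi> \<in> Mu" "finite A" "A \<subseteq> Ub" "e > 0"
  shows "\<exists>x. \<forall>f\<in>A. \<bar>f x - \<xi> f\<bar> < e"
  using closure_powertop_approx[of \<xi> Ub UNIV A e] assms
  unfolding Mu_def evU_def[abs_def] by blast

lemma evB_apply: "f \<in> Cb_til \<Longrightarrow> evB q f = f q"
  by (simp add: evB_def)

lemma topspace_betaTop [simp]: "topspace betaTop = betaM"
proof -
  have "betaM \<subseteq> topspace (powertop_real Cb_til)"
    unfolding betaM_def by (rule closure_of_subset_topspace)
  then show ?thesis by (auto simp: betaTop_def)
qed

lemma topspace_MuTop [simp]: "topspace MuTop = Mu"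
proof -
  have "Mu \<subseteq> topspace (powertop_real Ub)"
    unfolding Mu_def by (rule closure_of_subset_topspace)
  then show ?thesis by (auto simp: MuTop_def)
qed

lemma Hausdorff_betaTop: "Hausdorff_space betaTop"
  unfolding betaTop_def
  by (intro Hausdorff_space_subtopology) (auto simp: Hausdorff_space_product_topology)

lemma continuous_map_betaTop_eval:
  assumes "f \<in> Cb_til"
  shows "continuous_map betaTop euclideanreal (\<lambda>\<zeta>. \<zeta> f)"
  unfolding betaTop_def
  by (intro continuous_map_from_subtopology continuous_map_product_projection assms)

lemma openin_betaTop_eval:
  assumes "f \<in> Cb_til" "open S"
  shows "openin betaTop {\<zeta> \<in> betaM. \<zeta> f \<in> S}"
  using openin_continuous_map_preimage[OF continuous_map_betaTop_eval[OF assms(1)], of S] assms(2)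
  by simp

lemma continuous_on_coord: "continuous_on S (coord i)"
  unfolding coord_def by (cases "i = 1") (auto intro: continuous_intros)

lemma Ub_coord:
  assumes "f \<in> Ub"
  shows "(\<lambda>q. f (coord i q)) \<in> Cb_til"
proof -
  have "continuous_on UNIV f"
    using assms by (auto simp: Ub_def uniformly_continuous_imp_continuous)
  then have "continuous_on Mtil (\<lambda>q. f (coord i q))"
    by (rule continuous_on_compose2[OF _ continuous_on_coord]) auto
  moreover have "bounded ((\<lambda>q. f (coord i q)) ` Mtil)"
    by (rule bounded_subset[of "range f"]) (use assms in \<open>auto simp: Ub_def\<close>)
  ultimately show ?thesis by (simp add: Cb_til_def)
qed

lemma bounded_lipschitz_Ub:
  assumes "\<And>x. \<bar>h x\<bar> \<le> B" "\<And>x y. \<bar>h x - h y\<bar> \<le> dist x y"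
  shows "h \<in> Ub"
proof -
  have "uniformly_continuous_on UNIV h"
    unfolding uniformly_continuous_on_def
    using assms(2) by (metis dist_real_def order_le_less_trans)
  moreover have "bounded (range h)"
    using assms(1) by (auto simp: bounded_iff)
  ultimately show ?thesis by (simp add: Ub_def)
qed

lemma dist_min_Ub: "(\<lambda>x. min (dist x x0) (real n)) \<in> Ub"
proof (rule bounded_lipschitz_Ub)
  show "\<bar>min (dist x x0) (real n) - min (dist y x0) (real n)\<bar> \<le> dist x y" for x y
    using dist_triangle[of x x0 y] dist_triangle[of y x0 x] dist_commute[of x y] by (auto simp: min_def)
qed (auto simp: min_def)

lemma Lip_unit_Ub: "h \<in> Lip_unit \<Longrightarrow> h \<in> Ub"
  by (rule bounded_lipschitz_Ub[where B = 1]) (auto simp: Lip_unit_def)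

lemma pext_apply: "f \<in> Ub \<Longrightarrow> pext i \<xi> f = \<xi> (\<lambda>q. f (coord i q))"
  by (simp add: pext_def coord_def)

lemma pext_extensional: "pext i \<xi> \<in> extensional Ub"
  by (simp add: pext_def)

lemma pext_evB: "pext i (evB q) = evU (coord i q)"
proof
  fix f :: "'a \<Rightarrow> real"
  show "pext i (evB q) f = evU (coord i q) f"
  proof (cases "f \<in> Ub")
    case True
    then show ?thesis using Ub_coord[OF True, of i] by (simp add: pext_apply evB_def evU_def)
  next
    case False
    then show ?thesis by (simp add: pext_def evU_def)
  qed
qed

text \<open>Each coordinate of \<open>pext i\<close> is an evaluation, hence continuous. Since
  \<open>evB q\<close> is sent to \<open>evU (coord i q)\<close>, continuity carries the closure
  \<open>betaM\<close> into the closure \<open>Mu\<close>.\<close>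

lemma continuous_map_pext:
  "continuous_map betaTop MuTop (pext i :: (('a::metric_space \<times> 'a \<Rightarrow> real) \<Rightarrow> real) \<Rightarrow> _)"
proof -
  let ?p = "pext i :: (('a \<times> 'a \<Rightarrow> real) \<Rightarrow> real) \<Rightarrow> _"
  have c: "continuous_map (powertop_real Cb_til) (powertop_real Ub) ?p"
    unfolding continuous_map_componentwise
    using pext_extensional by (auto simp: pext_apply intro!: continuous_map_product_projection Ub_coord)
  have "?p ` evB ` Mtil \<subseteq> range evU"
    by (auto simp: pext_evB)
  then have "?p ` betaM \<subseteq> Mu"
    using continuous_map_image_closure_subset[OF c, of "evB ` Mtil"]
      closure_of_mono[of "?p ` evB ` Mtil" "range evU" "powertop_real Ub"]
    unfolding betaM_def Mu_def by (meson order_trans)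
  then show ?thesis
    unfolding betaTop_def MuTop_def
    by (intro continuous_map_into_subtopology continuous_map_from_subtopology c) auto
qed

lemma pext_Mu: "\<xi> \<in> betaM \<Longrightarrow> pext i \<xi> \<in> Mu"
  using continuous_map_image_subset_topspace[OF continuous_map_pext[of i]]
  by (auto simp: image_subset_iff)

text \<open>Passing through \<open>pext i\<close> gives approximation by a single point of
  \<open>M\<close>, where maxima, minima and cutoffs can be computed pointwise.\<close>

lemma Lip_unit_approx:
  assumes "\<xi> \<in> betaM" "finite A" "A \<subseteq> Lip_unit" "e > 0"
  shows "\<exists>x. \<forall>h\<in>A. \<bar>h x - \<xi> (\<lambda>q. h (coord i q))\<bar> < e"
proof -
  have A: "A \<subseteq> Ub" using assms(3) Lip_unit_Ub by blast
  then obtain x where x: "\<forall>h\<in>A. \<bar>h x - pext i \<xi> h\<bar> < e"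
    using Mu_approx[OF pext_Mu[OF assms(1)] assms(2) A assms(4)] by blast
  have "\<bar>h x - \<xi> (\<lambda>q. h (coord i q))\<bar> < e" if "h \<in> A" for h
  proof -
    have "\<bar>h x - pext i \<xi> h\<bar> < e" using x that by blast
    moreover have "pext i \<xi> h = \<xi> (\<lambda>q. h (coord i q))"
      by (rule pext_apply) (use that A in blast)
    ultimately show ?thesis by simp
  qed
  then show ?thesis by blast
qed

section \<open>Points of \<open>RM\<close> and the extensions of Lipschitz functions\<close>

lemma RM_iff:
  "\<xi> \<in> RM x0 \<longleftrightarrow> \<xi> \<in> Mu \<and> (\<exists>N::nat. \<forall>n::nat. \<xi> (\<lambda>x. min (dist x x0) (real n)) \<le> real N)"
proof -
  have "d0bar x0 \<xi> < \<infinity> \<longleftrightarrow> (\<exists>N::nat. d0bar x0 \<xi> \<le> ereal (real N))"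
  proof
    assume "d0bar x0 \<xi> < \<infinity>"
    then have "d0bar x0 \<xi> \<noteq> \<infinity>" by simp
    then show "\<exists>N::nat. d0bar x0 \<xi> \<le> ereal (real N)"
      unfolding less_PInf_Ex_of_nat by (meson less_imp_le)
  next
    assume "\<exists>N::nat. d0bar x0 \<xi> \<le> ereal (real N)"
    then obtain N :: nat where "d0bar x0 \<xi> \<le> ereal (real N)" ..
    also have "\<dots> < \<infinity>" by simp
    finally show "d0bar x0 \<xi> < \<infinity>" .
  qed
  then show ?thesis
    by (auto simp: RM_def d0bar_def SUP_le_iff)
qed

text \<open>The distance truncated one level above the bound for \<open>\<xi>\<close> is added to
  the finite family. An error below 1 then keeps it under its truncation level, so the truncation is
  inactive at \<open>x\<close>. The radius does not depend on \<open>A\<close> or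
  \<open>e\<close>.\<close>

lemma RM_approx:
  assumes "\<xi> \<in> RM x0"
  obtains N :: nat where
    "\<And>A e. finite A \<Longrightarrow> A \<subseteq> Ub \<Longrightarrow> e > 0 \<Longrightarrow> \<exists>x. dist x x0 < real N \<and> (\<forall>f\<in>A. \<bar>f x - \<xi> f\<bar> < e)"
proof -
  obtain N :: nat where \<xi>: "\<xi> \<in> Mu" and N: "\<And>n::nat. \<xi> (\<lambda>x. min (dist x x0) (real n)) \<le> real N"
    using assms by (auto simp: RM_iff)
  have "\<exists>x. dist x x0 < real (Suc N) \<and> (\<forall>f\<in>A. \<bar>f x - \<xi> f\<bar> < e)"
    if A: "finite A" "A \<subseteq> Ub" "e > 0" for A e
  proof -
    let ?d = "\<lambda>x. min (dist x x0) (real (Suc N))"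
    obtain x where x: "\<forall>f\<in>insert ?d A. \<bar>f x - \<xi> f\<bar> < min e 1"
      using Mu_approx[OF \<xi>, of "insert ?d A" "min e 1"] A dist_min_Ub[of x0 "Suc N"] by auto
    then have "\<bar>?d x - \<xi> ?d\<bar> < 1" by auto
    then have "?d x < real (Suc N)" using N[of "Suc N"] by linarith
    then show ?thesis using x by (intro exI[of _ x]) auto
  qed
  with that show ?thesis by blast
qed

text \<open>Approximating points can be taken in a ball of radius \<open>N\<close> about
  \<open>x0\<close>, where every truncation of \<open>f\<close> at a level \<open>n \<ge> N\<close>
  equals \<open>f\<close>. Hence the sequence defining \<open>fR\<close> is eventually constant, and
  the 1-Lipschitz operation of clamping commutes with evaluation at \<open>\<xi>\<close>.\<close>

lemma eval_clamped_abs_diff: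
  fixes c :: real
  assumes \<xi>: "\<xi> \<in> RM x0" and f: "f \<in> Lip0_ball x0"
  shows "\<xi> (\<lambda>x. min 1 \<bar>f x - c\<bar>) = min 1 \<bar>fR f \<xi> - c\<bar>"
proof -
  obtain N :: nat where
    N: "\<And>A e. finite A \<Longrightarrow> A \<subseteq> Ub \<Longrightarrow> e > 0 \<Longrightarrow> \<exists>x. dist x x0 < real N \<and> (\<forall>f\<in>A. \<bar>f x - \<xi> f\<bar> < e)"
    using RM_approx[OF \<xi>] by blast
  let ?t = "\<lambda>n::nat. \<lambda>x. max (- real n) (min (real n) (f x))"
  have lip: "\<bar>f x - f y\<bar> \<le> dist x y" and f0: "f x0 = 0" for x y
    using f by (auto simp: Lip0_ball_def Lip0_def)
  have t: "?t n \<in> Ub" for n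
  proof (rule bounded_lipschitz_Ub)
    show "\<bar>?t n x - ?t n y\<bar> \<le> dist x y" for x y
      using lip[of x y] by (auto simp: min_def max_def)
  qed (auto simp: min_def max_def)
  have h: "(\<lambda>x. min 1 \<bar>f x - c\<bar>) \<in> Ub"
  proof (rule bounded_lipschitz_Ub)
    show "\<bar>min 1 \<bar>f x - c\<bar> - min 1 \<bar>f y - c\<bar>\<bar> \<le> dist x y" for x y
      using lip[of x y] by (auto simp: min_def)
  qed (auto simp: min_def)
  have tx: "?t n x = f x" if "dist x x0 < real N" "N \<le> n" for n x
    using lip[of x x0] f0 that by (auto simp: min_def max_def)
  have eq: "\<xi> (?t n) = \<xi> (?t N)" if "N \<le> n" for n
  proof (rule ccontr)
    assume "\<xi> (?t n) \<noteq> \<xi> (?t N)"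
    then obtain x where "dist x x0 < real N" 
        "\<forall>f\<in>{?t n, ?t N}. \<bar>f x - \<xi> f\<bar> < \<bar>\<xi> (?t n) - \<xi> (?t N)\<bar> / 2"
      using N[of "{?t n, ?t N}" "\<bar>\<xi> (?t n) - \<xi> (?t N)\<bar> / 2"] t by auto
    then have "\<bar>f x - \<xi> (?t n)\<bar> < \<bar>\<xi> (?t n) - \<xi> (?t N)\<bar> / 2"
      "\<bar>f x - \<xi> (?t N)\<bar> < \<bar>\<xi> (?t n) - \<xi> (?t N)\<bar> / 2"
      using tx[of x n] tx[of x N] that by auto
    moreover have "\<bar>r - a\<bar> < \<bar>a - b\<bar> / 2 \<Longrightarrow> \<bar>r - b\<bar> < \<bar>a - b\<bar> / 2 \<Longrightarrow> False" for r a b :: real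
      using abs_triangle_ineq4[of "r - b" "r - a"] by simp
    ultimately show False by blast
  qed
  have "(\<lambda>n. \<xi> (?t n)) \<longlonglongrightarrow> \<xi> (?t N)"
    by (rule tendsto_eventually, rule eventually_sequentiallyI[of N], rule eq)
  then have fR: "fR f \<xi> = \<xi> (?t N)"
    unfolding fR_def by (rule limI)
  let ?h = "\<lambda>x. min 1 \<bar>f x - c\<bar>"
  show ?thesis
  proof (rule ccontr)
    assume ne: "\<xi> ?h \<noteq> min 1 \<bar>fR f \<xi> - c\<bar>"
    define e where "e = \<bar>\<xi> ?h - min 1 \<bar>fR f \<xi> - c\<bar>\<bar> / 2"
    have "e > 0" using ne by (simp add: e_def)
    then obtain x where x: "dist x x0 < real N" "\<forall>f\<in>{?h, ?t N}. \<bar>f x - \<xi> f\<bar> < e"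
      using N[of "{?h, ?t N}" e] t h by auto
    then have "\<bar>?h x - \<xi> ?h\<bar> < e" "\<bar>f x - fR f \<xi>\<bar> < e"
      using tx[of x N] fR by auto
    moreover have "\<bar>min 1 \<bar>a - c\<bar> - min 1 \<bar>b - c\<bar>\<bar> \<le> \<bar>a - b\<bar>" for a b :: real
      by (auto simp: min_def)
    from this[of "f x" "fR f \<xi>"]
    have "\<bar>?h x - min 1 \<bar>fR f \<xi> - c\<bar>\<bar> \<le> \<bar>f x - fR f \<xi>\<bar>" .
    ultimately have "\<bar>\<xi> ?h - min 1 \<bar>fR f \<xi> - c\<bar>\<bar> < 2 * e"
      using abs_triangle_ineq4[of "?h x - min 1 \<bar>fR f \<xi> - c\<bar>" "?h x - \<xi> ?h"] by simp
    then show False by (simp add: e_def)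
  qed
qed

text \<open>Some \<open>f\<close> in the unit ball nearly attains the distance, and \<open>h\<close>
  is the clamped distance of \<open>f\<close> from its value at \<open>\<eta>\<close>. Settling for
  \<open>e / 2\<close> makes the inequality strict.\<close>

lemma dbar_far_separation:
  assumes E: "E \<subseteq> RM x0" and \<xi>: "\<xi> \<in> RM x0"
    and far: "e > 0" "\<forall>\<eta>\<in>E. \<not> dbar x0 \<xi> \<eta> < e" and \<eta>: "\<eta> \<in> E"
  shows "\<exists>h\<in>Lip_unit. \<xi> h > min 1 e / 2 \<and> \<eta> h = 0"
proof -
  have ne: "Lip0_ball x0 \<noteq> {}"
    by (auto simp: Lip0_ball_def Lip0_def intro!: exI[of _ "\<lambda>_. 0"] exI[of _ 0])
  have "\<exists>f\<in>Lip0_ball x0. \<bar>fR f \<xi> - fR f \<eta>\<bar> > e / 2"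
  proof (rule ccontr)
    assume "\<not> ?thesis"
    then have "dbar x0 \<xi> \<eta> \<le> e / 2"
      unfolding dbar_def by (intro cSUP_least ne) (auto simp: not_less)
    then show False using far \<eta> by force
  qed
  then obtain f where f: "f \<in> Lip0_ball x0" "\<bar>fR f \<xi> - fR f \<eta>\<bar> > e / 2" by blast
  let ?h = "\<lambda>x. min 1 \<bar>f x - fR f \<eta>\<bar>"
  have lip: "\<bar>f x - f y\<bar> \<le> dist x y" for x y
    using f by (auto simp: Lip0_ball_def)
  have "\<bar>?h x - ?h y\<bar> \<le> dist x y" for x y
    using lip[of x y] by (auto simp: min_def)
  then have "?h \<in> Lip_unit"
    by (auto simp: Lip_unit_def)
  moreover have "\<xi> ?h > min 1 e / 2"
    using eval_clamped_abs_diff[OF \<xi> f(1)] f(2) by auto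
  moreover have "\<eta> ?h = 0"
    using eval_clamped_abs_diff[OF _ f(1), of \<eta>] E \<eta> by auto
  ultimately show ?thesis by blast
qed

section \<open>Lipschitz functions separating compact sets\<close>

text \<open>\<open>H\<close> is the pointwise maximum of \<open>A\<close> together with the constant
  0, which covers the case of empty \<open>A\<close>.\<close>

lemma Lip_unit_Max:
  assumes "finite A" "A \<subseteq> Lip_unit"
  shows "\<exists>H\<in>Lip_unit. \<forall>x. (\<forall>h\<in>A. h x \<le> H x) \<and> (H x = 0 \<or> (\<exists>h\<in>A. H x = h x))"
  using assms
proof (induction A)
  case empty
  show ?case by (intro bexI[of _ "\<lambda>_. 0"]) (auto simp: Lip_unit_def)
next
  case (insert h A)
  then obtain H where H: "H \<in> Lip_unit"
    "\<And>x. (\<forall>h\<in>A. h x \<le> H x) \<and> (H x = 0 \<or> (\<exists>h\<in>A. H x = h x))" by auto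
  have "\<bar>max (h x) (H x) - max (h y) (H y)\<bar> \<le> dist x y" for x y
  proof -
    have "\<bar>h x - h y\<bar> \<le> dist x y" "\<bar>H x - H y\<bar> \<le> dist x y"
      using H(1) insert.prems by (auto simp: Lip_unit_def)
    then show ?thesis by (auto simp: max_def)
  qed
  then have "(\<lambda>x. max (h x) (H x)) \<in> Lip_unit"
    using H(1) insert.prems by (auto simp: Lip_unit_def max_def)
  moreover have "(\<forall>k\<in>insert h A. k x \<le> max (h x) (H x)) \<and>
      (max (h x) (H x) = 0 \<or> (\<exists>k\<in>insert h A. max (h x) (H x) = k x))" for x
    using H(2)[of x] by (auto simp: max_def)
  ultimately show ?case by (intro bexI[of _ "\<lambda>x. max (h x) (H x)"]) auto
qed

text \<open>\<open>Lip_unit\<close> is invariant under \<open>h \<mapsto> 1 - h\<close>, which turns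
  maxima into minima and the default 0 into 1.\<close>

lemma Lip_unit_Min:
  assumes "finite A" "A \<subseteq> Lip_unit"
  shows "\<exists>H\<in>Lip_unit. \<forall>x. (\<forall>h\<in>A. H x \<le> h x) \<and> (H x = 1 \<or> (\<exists>h\<in>A. H x = h x))"
proof -
  let ?c = "\<lambda>h::'a \<Rightarrow> real. \<lambda>x. 1 - h x"
  have c: "?c h \<in> Lip_unit" if "h \<in> Lip_unit" for h
    using that by (auto simp: Lip_unit_def abs_minus_commute)
  obtain H where H: "H \<in> Lip_unit"
    "\<And>x. (\<forall>h\<in>?c ` A. h x \<le> H x) \<and> (H x = 0 \<or> (\<exists>h\<in>?c ` A. H x = h x))"
    using Lip_unit_Max[of "?c ` A"] assms c by blast
  have "(\<forall>h\<in>A. 1 - H x \<le> h x) \<and> (1 - H x = 1 \<or> (\<exists>h\<in>A. 1 - H x = h x))" for x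
    using H(2)[of x] by fastforce
  then show ?thesis using c[OF H(1)] by (intro bexI[of _ "?c H"]) auto
qed

lemma Lip_unit_cutoff:
  assumes "h \<in> Lip_unit" "0 \<le> c"
  shows "(\<lambda>x. max 0 (h x - c)) \<in> Lip_unit"
proof -
  have "\<bar>max 0 (h x - c) - max 0 (h y - c)\<bar> \<le> dist x y" for x y
  proof -
    have "\<bar>h x - h y\<bar> \<le> dist x y" using assms by (auto simp: Lip_unit_def)
    then show ?thesis by (auto simp: max_def)
  qed
  moreover have "max 0 (h x - c) \<le> 1" for x
  proof -
    have "h x \<le> 1" using assms by (auto simp: Lip_unit_def)
    then show ?thesis using assms(2) by auto
  qed
  ultimately show ?thesis by (auto simp: Lip_unit_def)
qed

lemma compact_finite_eval_cover:
  assumes K: "compactin betaTop K" and S: "open S" and A: "A \<subseteq> Lip_unit"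
    and cov: "\<And>\<zeta>. \<zeta> \<in> K \<Longrightarrow> \<exists>h\<in>A. \<zeta> (\<lambda>q. h (coord i q)) \<in> S"
  obtains A' where "finite A'" "A' \<subseteq> A" "\<And>\<zeta>. \<zeta> \<in> K \<Longrightarrow> \<exists>h\<in>A'. \<zeta> (\<lambda>q. h (coord i q)) \<in> S"
proof -
  let ?U = "\<lambda>h. {\<zeta> \<in> betaM. \<zeta> (\<lambda>q. h (coord i q)) \<in> S}"
  have KM: "K \<subseteq> betaM" using K compactin_subset_topspace by fastforce
  have "\<exists>\<F>. finite \<F> \<and> \<F> \<subseteq> ?U ` A \<and> K \<subseteq> \<Union>\<F>"
  proof (rule compactinD[OF K])
    show "openin betaTop U" if "U \<in> ?U ` A" for U
      using that A S by (auto intro!: openin_betaTop_eval Ub_coord Lip_unit_Ub)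
    show "K \<subseteq> \<Union> (?U ` A)" using cov KM by fastforce
  qed
  then obtain \<F> where F: "finite \<F>" "\<F> \<subseteq> ?U ` A" "K \<subseteq> \<Union>\<F>" by blast
  then obtain A' where "A' \<subseteq> A" "finite A'" "\<F> = ?U ` A'"
    by (meson finite_subset_image)
  then show ?thesis using F(3) by (intro that[of A']) auto
qed

text \<open>Finitely many of the sets where an \<open>h\<close> is below \<open>e / 2\<close> cover
  \<open>K\<close>. The minimum \<open>G\<close> of these \<open>h\<close> is at least
  \<open>e\<close> at \<open>\<xi>\<close> (its default value 1 is why \<open>e \<le> 1\<close> is
  assumed) and below \<open>e / 2\<close> on \<open>K\<close>, so subtracting \<open>e / 2\<close>
  and taking the positive part gives exact vanishing on \<open>K\<close>.\<close>

lemma compact_zero_separation: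
  assumes K: "compactin betaTop K" and \<xi>: "\<xi> \<in> betaM" and e: "0 < e" "e \<le> 1"
    and sep: "\<And>\<zeta>. \<zeta> \<in> K \<Longrightarrow> \<exists>h\<in>Lip_unit. \<xi> (\<lambda>q. h (coord i q)) > e \<and> \<zeta> (\<lambda>q. h (coord i q)) = 0"
  shows "\<exists>h\<in>Lip_unit. \<xi> (\<lambda>q. h (coord i q)) \<ge> e / 2 \<and> (\<forall>\<zeta>\<in>K. \<zeta> (\<lambda>q. h (coord i q)) = 0)"
proof -
  let ?v = "\<lambda>h q. h (coord i q) :: real"
  have KM: "K \<subseteq> betaM" using K compactin_subset_topspace by fastforce
  obtain A where A: "finite A" "A \<subseteq> {h \<in> Lip_unit. \<xi> (?v h) > e}"
    "\<And>\<zeta>. \<zeta> \<in> K \<Longrightarrow> \<exists>h\<in>A. \<zeta> (?v h) \<in> {..<e/2}"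
  proof (rule compact_finite_eval_cover[OF K, of "{..<e/2}" "{h \<in> Lip_unit. \<xi> (?v h) > e}" i])
    show "\<exists>h\<in>{h \<in> Lip_unit. \<xi> (?v h) > e}. \<zeta> (?v h) \<in> {..<e/2}" if "\<zeta> \<in> K" for \<zeta>
      using sep[OF that] e by force
  qed auto
  obtain G where G: "G \<in> Lip_unit" "\<And>x. (\<forall>h\<in>A. G x \<le> h x) \<and> (G x = 1 \<or> (\<exists>h\<in>A. G x = h x))"
    using Lip_unit_Min[of A] A by blast
  let ?H = "\<lambda>x. max 0 (G x - e/2)"
  have H: "?H \<in> Lip_unit" using Lip_unit_cutoff[OF G(1)] e by simp
  have AH: "insert ?H A \<subseteq> Lip_unit" using H A(2) by auto
  have "\<xi> (?v ?H) \<ge> e / 2"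
  proof (rule field_le_epsilon)
    fix d :: real assume "d > 0"
    then obtain x where x: "\<forall>h\<in>insert ?H A. \<bar>h x - \<xi> (?v h)\<bar> < d / 2"
      using Lip_unit_approx[OF \<xi>, of "insert ?H A" "d/2" i] A(1) AH by auto
    have "h x > e - d / 2" if "h \<in> A" for h
    proof -
      have "\<bar>h x - \<xi> (?v h)\<bar> < d / 2" "\<xi> (?v h) > e" using x that A(2) by auto
      then show ?thesis by linarith
    qed
    then have "G x \<ge> e - d / 2"
      using G(2)[of x] e \<open>d > 0\<close> by force
    moreover have "\<bar>?H x - \<xi> (?v ?H)\<bar> < d / 2" by (rule bspec[OF x insertI1])
    ultimately show "e / 2 \<le> \<xi> (?v ?H) + d" by linarith
  qed
  moreover have "\<zeta> (?v ?H) = 0" if "\<zeta> \<in> K" for \<zeta>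
  proof (rule ccontr)
    assume ne: "\<zeta> (?v ?H) \<noteq> 0"
    obtain h where h: "h \<in> A" "\<zeta> (?v h) < e / 2" using A(3)[OF \<open>\<zeta> \<in> K\<close>] by auto
    define d where "d = min (e / 2 - \<zeta> (?v h)) \<bar>\<zeta> (?v ?H)\<bar>"
    have "d > 0" using ne h by (simp add: d_def)
    then obtain x where x: "\<forall>h\<in>insert ?H A. \<bar>h x - \<zeta> (?v h)\<bar> < d"
      using Lip_unit_approx[of \<zeta> "insert ?H A" d i] A(1) AH KM \<open>\<zeta> \<in> K\<close> by auto
    then have "\<bar>h x - \<zeta> (?v h)\<bar> < d" "\<bar>?H x - \<zeta> (?v ?H)\<bar> < d" using h by simp_all
    then have "h x < e / 2" "?H x \<noteq> 0" by (auto simp: d_def)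
    then show False using G(2)[of x] h(1) by force
  qed
  ultimately show ?thesis using H by (intro bexI[of _ ?H]) auto
qed

text \<open>The dual argument: the maximum of finitely many functions that cover \<open>L\<close> is
  large on all of \<open>L\<close>, and it still vanishes on \<open>K\<close> because each of them
  does.\<close>

lemma compact_positive_separation:
  assumes L: "compactin betaTop L" and K: "K \<subseteq> betaM"
    and sep: "\<And>\<xi>. \<xi> \<in> L \<Longrightarrow> \<exists>h\<in>Lip_unit. \<xi> (\<lambda>q. h (coord i q)) > e \<and> (\<forall>\<zeta>\<in>K. \<zeta> (\<lambda>q. h (coord i q)) = 0)"
  shows "\<exists>h\<in>Lip_unit. (\<forall>\<xi>\<in>L. \<xi> (\<lambda>q. h (coord i q)) \<ge> e) \<and> (\<forall>\<zeta>\<in>K. \<zeta> (\<lambda>q. h (coord i q)) = 0)"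
proof -
  let ?v = "\<lambda>h q. h (coord i q) :: real"
  have LM: "L \<subseteq> betaM" using L compactin_subset_topspace by fastforce
  obtain A where A: "finite A" "A \<subseteq> {h \<in> Lip_unit. \<forall>\<zeta>\<in>K. \<zeta> (?v h) = 0}"
    "\<And>\<zeta>. \<zeta> \<in> L \<Longrightarrow> \<exists>h\<in>A. \<zeta> (?v h) \<in> {e<..}"
  proof (rule compact_finite_eval_cover[OF L, of "{e<..}" "{h \<in> Lip_unit. \<forall>\<zeta>\<in>K. \<zeta> (?v h) = 0}" i])
    show "\<exists>h\<in>{h \<in> Lip_unit. \<forall>\<zeta>\<in>K. \<zeta> (?v h) = 0}. \<zeta> (?v h) \<in> {e<..}" if "\<zeta> \<in> L" for \<zeta>
      using sep[OF that] by force
  qed auto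
  obtain H where H: "H \<in> Lip_unit" "\<And>x. (\<forall>h\<in>A. h x \<le> H x) \<and> (H x = 0 \<or> (\<exists>h\<in>A. H x = h x))"
    using Lip_unit_Max[of A] A by blast
  have AH: "insert H A \<subseteq> Lip_unit" using H A(2) by auto
  have "\<xi> (?v H) \<ge> e" if "\<xi> \<in> L" for \<xi>
  proof (rule field_le_epsilon)
    fix d :: real assume "d > 0"
    then obtain x where x: "\<forall>h\<in>insert H A. \<bar>h x - \<xi> (?v h)\<bar> < d / 2"
      using Lip_unit_approx[of \<xi> "insert H A" "d/2" i] A(1) AH LM \<open>\<xi> \<in> L\<close> by auto
    obtain h where h: "h \<in> A" "\<xi> (?v h) > e" using A(3)[OF \<open>\<xi> \<in> L\<close>] by auto
    have "\<bar>h x - \<xi> (?v h)\<bar> < d / 2" "\<bar>H x - \<xi> (?v H)\<bar> < d / 2" using x h(1) by auto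
    moreover have "h x \<le> H x" using H(2) h(1) by blast
    ultimately show "e \<le> \<xi> (?v H) + d" using h(2) by linarith
  qed
  moreover have "\<zeta> (?v H) = 0" if "\<zeta> \<in> K" for \<zeta>
  proof (rule ccontr)
    assume ne: "\<zeta> (?v H) \<noteq> 0"
    define d where "d = \<bar>\<zeta> (?v H)\<bar> / 2"
    have "d > 0" using ne by (simp add: d_def)
    then obtain x where x: "\<forall>h\<in>insert H A. \<bar>h x - \<zeta> (?v h)\<bar> < d"
      using Lip_unit_approx[of \<zeta> "insert H A" d i] A(1) AH K \<open>\<zeta> \<in> K\<close> by auto
    have "\<bar>h x\<bar> < d" if "h \<in> A" for h
    proof -
      have "\<zeta> (?v h) = 0" using A(2) that \<open>\<zeta> \<in> K\<close> by blast
      then show ?thesis using bspec[OF x, of h] that by simp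
    qed
    then have "\<bar>H x\<bar> < d" using H(2)[of x] \<open>d > 0\<close> by auto
    moreover have "\<bar>H x - \<zeta> (?v H)\<bar> < d" by (rule bspec[OF x insertI1])
    ultimately show False unfolding d_def by linarith
  qed
  ultimately show ?thesis using H(1) by (intro bexI[of _ H]) auto
qed

section \<open>Transfer by density, and slopes as members of the cone\<close>

lemma evB_betaM: "q \<in> Mtil \<Longrightarrow> evB q \<in> betaM"
  unfolding betaM_def
  by (rule subsetD[OF closure_of_subset]) (auto simp: evB_def)

text \<open>The points \<open>evB q\<close> are dense, so a closed condition checked at those lying
  in \<open>U\<close> extends to all of \<open>U\<close>. Taking \<open>S\<close> empty refutes the
  existence of a point in \<open>U\<close>.\<close>

lemma betaM_eval_closed:
  assumes U: "openin betaTop U" "\<zeta> \<in> U" and f: "f \<in> Cb_til" and S: "closed S"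
    and q: "\<And>q. q \<in> Mtil \<Longrightarrow> evB q \<in> U \<Longrightarrow> f q \<in> S"
  shows "\<zeta> f \<in> S"
proof (rule ccontr)
  assume n: "\<zeta> f \<notin> S"
  have "openin betaTop (U \<inter> {\<zeta> \<in> betaM. \<zeta> f \<in> - S})"
    using S by (intro openin_Int U openin_betaTop_eval f) auto
  then obtain T where T: "openin (powertop_real Cb_til) T" "U \<inter> {\<zeta> \<in> betaM. \<zeta> f \<in> - S} = T \<inter> betaM"
    unfolding betaTop_def openin_subtopology by blast
  have "\<zeta> \<in> betaM" using openin_subset[OF U(1)] U(2) by auto
  then have "\<zeta> \<in> T" using T(2) n U(2) by blast
  then obtain q where "q \<in> Mtil" "evB q \<in> T"
    using \<open>\<zeta> \<in> betaM\<close> T(1) unfolding betaM_def in_closure_of by blast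
  then have "evB q \<in> U" "evB q f \<notin> S"
    using T(2) evB_betaM by blast+
  then show False using q[OF \<open>q \<in> Mtil\<close>] f by (simp add: evB_def)
qed

lemma slope_Cb_til:
  assumes "continuous_on UNIV h" "\<And>x. 0 \<le> h x"
  shows "slope i h \<in> Cb_til"
proof -
  have "continuous_on Mtil (\<lambda>q. h (coord i q))"
    by (rule continuous_on_compose2[OF assms(1) continuous_on_coord]) auto
  then have "continuous_on Mtil (slope i h)"
    unfolding slope_def
    by (intro continuous_intros) (auto simp: Mtil_def)
  moreover have "norm (slope i h q) \<le> 1" for q
    using assms(2)[of "coord i q"] by (simp add: slope_def)
  then have "bounded (slope i h ` Mtil)"
    unfolding bounded_iff by blast
  ultimately show ?thesis by (simp add: Cb_til_def)
qed

lemma lipschitz_continuous: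
  fixes h :: "'a::metric_space \<Rightarrow> real"
  assumes "\<And>x y. \<bar>h x - h y\<bar> \<le> dist x y"
  shows "continuous_on UNIV h"
  unfolding continuous_on_iff using assms
  by (metis dist_real_def order_le_less_trans)

text \<open>Multiplication by \<open>dist x y\<close> turns the slope into
  \<open>min (dist x y) (h (coord i (x, y)))\<close>. If both minima on the right are distances, the
  triangle inequality applies; the remaining cases use \<open>h \<ge> 0\<close> and the Lipschitz
  bound along one of the two legs.\<close>

lemma slope_Gcone:
  assumes h: "\<And>x. 0 \<le> h x" "\<And>x y. \<bar>h x - h y\<bar> \<le> dist x y"
  shows "(\<lambda>\<zeta>. \<zeta> (slope i h)) \<in> Gcone"
proof -
  have s: "slope i h \<in> Cb_til"
    by (intro slope_Cb_til lipschitz_continuous h)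
  have m: "dist x y * slope i h (x, y) = min (dist x y) (h (coord i (x, y)))" if "x \<noteq> y" for x y
    using that by (simp add: slope_def min_def field_simps)
  have "min (dist x y) (h (coord i (x, y)))
      \<le> min (dist x u) (h (coord i (x, u))) + min (dist u y) (h (coord i (u, y)))" for x u y
    using h(1)[of x] h(1)[of u] h(1)[of y] h(2)[of x u] h(2)[of u y] dist_triangle[of x y u]
    by (auto simp: coord_def min_def)
  then show ?thesis
    using s by (auto simp: Gcone_def continuous_map_betaTop_eval evB_apply m)
qed

lemma slope_bounds:
  assumes "\<And>x. 0 \<le> h x"
  shows "0 \<le> slope i h q" "slope i h q \<le> 1"
  using assms by (auto simp: slope_def)

section \<open>Radon measures on \<open>betaM\<close> and the basic estimate\<close>

lemma radon_space: "radon_pos betaTop \<mu> \<Longrightarrow> space \<mu> = betaM"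
  by (simp add: radon_pos_def)

lemma sets_radon_open:
  assumes "radon_pos betaTop \<mu>" "openin betaTop U"
  shows "U \<in> sets \<mu>"
proof -
  have "{U. openin betaTop U} \<subseteq> Pow (topspace betaTop)"
    using openin_subset by blast
  then show ?thesis
    using assms by (auto simp: radon_pos_def borel_of_def sets_measure_of)
qed

lemma measurable_radon_eval:
  assumes "radon_pos betaTop \<mu>" "f \<in> Cb_til"
  shows "(\<lambda>\<zeta>. \<zeta> f) \<in> borel_measurable \<mu>"
proof (rule borel_measurableI)
  fix S :: "real set" assume "open S"
  then have "openin betaTop {\<zeta> \<in> betaM. \<zeta> f \<in> S}"
    by (intro openin_betaTop_eval assms)
  moreover have "(\<lambda>\<zeta>. \<zeta> f) -` S \<inter> space \<mu> = {\<zeta> \<in> betaM. \<zeta> f \<in> S}"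
    by (auto simp: radon_space[OF assms(1)])
  ultimately show "(\<lambda>\<zeta>. \<zeta> f) -` S \<inter> space \<mu> \<in> sets \<mu>"
    using sets_radon_open[OF assms(1)] by simp
qed

lemma sets_radon_eval:
  assumes "radon_pos betaTop \<mu>" "f \<in> Cb_til" "S \<in> sets borel"
  shows "{\<zeta> \<in> betaM. \<zeta> f \<in> S} \<in> sets \<mu>"
proof -
  have "(\<lambda>\<zeta>. \<zeta> f) -` S \<inter> space \<mu> = {\<zeta> \<in> betaM. \<zeta> f \<in> S}"
    by (auto simp: radon_space[OF assms(1)])
  then show ?thesis
    using measurable_sets[OF measurable_radon_eval[OF assms(1,2)] assms(3)] by simp
qed

lemma sets_radon_compact:
  assumes "radon_pos betaTop \<mu>" "compactin betaTop K"
  shows "K \<in> sets \<mu>"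
proof -
  have "closedin betaTop K"
    using compactin_imp_closedin[OF Hausdorff_betaTop assms(2)] .
  then have "openin betaTop (betaM - K)" "K \<subseteq> betaM"
    by (auto simp: closedin_def)
  then have "space \<mu> - (betaM - K) \<in> sets \<mu>"
    by (intro sets.compl_sets sets_radon_open assms)
  moreover have "space \<mu> - (betaM - K) = K"
    using \<open>K \<subseteq> betaM\<close> by (auto simp: radon_space[OF assms(1)])
  ultimately show ?thesis by simp
qed

lemma radon_inner:
  assumes r: "radon_pos betaTop \<mu>" and B: "B \<in> sets \<mu>" and e: "e > 0"
  shows "\<exists>K. compactin betaTop K \<and> K \<subseteq> B \<and> measure \<mu> (B - K) < e"
proof (cases "measure \<mu> B < e")
  \<comment> \<open>Treated apart so that \<open>?m - e / 2\<close> is nonnegative in the other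
    case; \<open>ennreal\<close> would send a negative number to 0.\<close>
  case True
  then show ?thesis by (intro exI[of _ "{}"]) auto
next
  case False
  interpret finite_measure \<mu> using r by (simp add: radon_pos_def)
  let ?m = "measure \<mu> B"
  have "ennreal (?m - e / 2) < emeasure \<mu> B"
    using e False by (simp add: emeasure_eq_measure ennreal_less_iff)
  also have "emeasure \<mu> B = (SUP K \<in> {K. compactin betaTop K \<and> K \<subseteq> B}. emeasure \<mu> K)"
    using r B by (simp add: radon_pos_def)
  finally obtain K where K: "compactin betaTop K" "K \<subseteq> B" "ennreal (?m - e / 2) < emeasure \<mu> K"
    unfolding less_SUP_iff by blast
  then have "?m - e / 2 < measure \<mu> K"
    using e False by (simp add: emeasure_eq_measure ennreal_less_iff)
  moreover have "measure \<mu> (B - K) = ?m - measure \<mu> K"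
    using B K sets_radon_compact[OF r] by (intro finite_measure_Diff) auto
  ultimately show ?thesis using K e by (intro exI[of _ K]) auto
qed

text \<open>Needed for \<open>far_part\<close>: a single function with a uniform lower bound is
  available only on its compact subsets.\<close>

lemma radon_null:
  assumes r: "radon_pos betaTop \<mu>" and A: "A \<in> sets \<mu>"
    and K: "\<And>K. compactin betaTop K \<Longrightarrow> K \<subseteq> A \<Longrightarrow> measure \<mu> K = 0"
  shows "measure \<mu> A = 0"
proof (rule ccontr)
  interpret finite_measure \<mu> using r by (simp add: radon_pos_def)
  assume "measure \<mu> A \<noteq> 0"
  then have "measure \<mu> A > 0" using measure_nonneg[of \<mu> A] by linarith
  then obtain L where L: "compactin betaTop L" "L \<subseteq> A" "measure \<mu> (A - L) < measure \<mu> A"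
    using radon_inner[OF r A] by blast
  have "measure \<mu> (A - L) = measure \<mu> A - measure \<mu> L"
    using A L sets_radon_compact[OF r] by (intro finite_measure_Diff) auto
  with K[OF L(1,2)] L(3) show False by simp
qed

text \<open>A Chebyshev-type estimate: the slope lies above \<open>c\<close> times the indicator of
  \<open>A\<close> and below the indicator of the complement of \<open>K\<close>, and
  \<open>preceq\<close> compares its two integrals.\<close>

lemma preceq_slope_bound:
  assumes \<mu>: "radon_pos betaTop \<mu>" and \<nu>: "radon_pos betaTop \<nu>" and prec: "preceq \<mu> \<nu>"
    and h: "\<And>x. 0 \<le> h x" "\<And>x y. \<bar>h x - h y\<bar> \<le> dist x y"
    and K: "K \<in> sets \<nu>" "\<And>\<zeta>. \<zeta> \<in> K \<Longrightarrow> \<zeta> (slope i h) = 0"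
    and A: "A \<in> sets \<mu>" "\<And>\<zeta>. \<zeta> \<in> A \<Longrightarrow> c \<le> \<zeta> (slope i h)"
  shows "c * measure \<mu> A \<le> measure \<nu> (betaM - K)"
proof -
  interpret \<mu>: finite_measure \<mu> using \<mu> by (simp add: radon_pos_def)
  interpret \<nu>: finite_measure \<nu> using \<nu> by (simp add: radon_pos_def)
  let ?g = "\<lambda>\<zeta>. \<zeta> (slope i h)"
  have s: "slope i h \<in> Cb_til"
    by (intro slope_Cb_til lipschitz_continuous h)
  have g: "?g \<zeta> \<in> {0..1}" if "\<zeta> \<in> betaM" for \<zeta>
    by (rule betaM_eval_closed[of betaM \<zeta> "slope i h"])
      (use that s slope_bounds[of h, OF h(1)] openin_topspace[of betaTop] in auto)
  have i\<mu>: "integrable \<mu> ?g"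
    by (rule \<mu>.integrable_const_bound[where B = 1])
      (use g measurable_radon_eval[OF \<mu> s] in \<open>auto simp: radon_space[OF \<mu>]\<close>)
  have i\<nu>: "integrable \<nu> ?g"
    by (rule \<nu>.integrable_const_bound[where B = 1])
      (use g measurable_radon_eval[OF \<nu> s] in \<open>auto simp: radon_space[OF \<nu>]\<close>)
  have AM: "A \<subseteq> betaM" using sets.sets_into_space[OF A(1)] radon_space[OF \<mu>] by simp
  have Kc: "betaM - K \<in> sets \<nu>"
    using sets.compl_sets[OF K(1)] radon_space[OF \<nu>] by simp
  have "c * measure \<mu> A = (\<integral>\<zeta>. c * indicator A \<zeta> \<partial>\<mu>)"
    using A(1) by simp
  also have "\<dots> \<le> integral\<^sup>L \<mu> ?g"
  proof (rule integral_mono)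
    show "integrable \<mu> (\<lambda>\<zeta>. c * indicator A \<zeta>)"
      using A(1) by (intro integrable_mult_right integrable_real_indicator) (auto simp: \<mu>.emeasure_eq_measure)
    show "c * indicator A \<zeta> \<le> ?g \<zeta>" if "\<zeta> \<in> space \<mu>" for \<zeta>
      using that A(2)[of \<zeta>] g[of \<zeta>] by (auto simp: radon_space[OF \<mu>] indicator_def)
  qed (rule i\<mu>)
  also have "\<dots> \<le> integral\<^sup>L \<nu> ?g"
    using prec slope_Gcone[of h i, OF h] by (auto simp: preceq_def)
  also have "\<dots> \<le> (\<integral>\<zeta>. indicator (betaM - K) \<zeta> \<partial>\<nu>)"
  proof (rule integral_mono)
    show "integrable \<nu> (indicator (betaM - K) :: _ \<Rightarrow> real)"
      using Kc by (intro integrable_real_indicator) (auto simp: \<nu>.emeasure_eq_measure)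
    show "?g \<zeta> \<le> indicator (betaM - K) \<zeta>" if "\<zeta> \<in> space \<nu>" for \<zeta>
      using that K(2)[of \<zeta>] g[of \<zeta>] by (auto simp: radon_space[OF \<nu>] indicator_def)
  qed (rule i\<nu>)
  also have "\<dots> = measure \<nu> (betaM - K)"
    using Kc by simp
  finally show ?thesis .
qed

section \<open>The bounded part of \<open>betaM\<close>, and the absence of mass outside it\<close>

definition tdist :: "'a::metric_space \<Rightarrow> nat \<Rightarrow> nat \<Rightarrow> 'a \<times> 'a \<Rightarrow> real" where
  "tdist x0 n j q = min (dist (coord j q) x0) (real n)"

text \<open>This is the set \<open>\<R>\<close> of the overview.\<close>

definition bounded_part :: "'a::metric_space \<Rightarrow> (('a \<times> 'a \<Rightarrow> real) \<Rightarrow> real) set" where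
  "bounded_part x0 = {\<zeta> \<in> betaM. pext 1 \<zeta> \<in> RM x0 \<and> pext 2 \<zeta> \<in> RM x0}"

lemma tdist_Cb_til: "tdist x0 n j \<in> Cb_til"
  unfolding tdist_def[abs_def] by (rule Ub_coord[OF dist_min_Ub])

text \<open>Expresses finiteness of the extended distance by countably many evaluations, which
  yields measurability of \<open>bounded_part\<close>.\<close>

lemma pext_RM_iff:
  assumes "\<zeta> \<in> betaM"
  shows "pext j \<zeta> \<in> RM x0 \<longleftrightarrow> (\<exists>N::nat. \<forall>n. \<zeta> (tdist x0 n j) \<le> real N)"
  unfolding RM_iff tdist_def[abs_def] using pext_Mu[OF assms] by (simp add: pext_apply dist_min_Ub)

lemma sets_bounded_part:
  assumes "radon_pos betaTop \<mu>"
  shows "bounded_part x0 \<in> sets \<mu>"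
proof -
  have "bounded_part x0 = (\<Union>N::nat. \<Inter>n. {\<zeta> \<in> betaM. \<zeta> (tdist x0 n 1) \<in> {..real N}}) \<inter>
     (\<Union>N::nat. \<Inter>n. {\<zeta> \<in> betaM. \<zeta> (tdist x0 n 2) \<in> {..real N}})"
    by (auto simp: bounded_part_def pext_RM_iff; blast)
  also have "\<dots> \<in> sets \<mu>"
    by (intro sets.Int sets.countable_UN sets.countable_INT image_subsetI
        sets_radon_eval[OF assms] tdist_Cb_til) auto
  finally show ?thesis .
qed

lemma topspace_RMTop [simp]: "topspace (RMTop x0) = RM x0"
  by (auto simp: RMTop_def RM_def)

text \<open>Induction over the generated sigma-algebra. An open set of \<open>RM\<close> is the
  trace of an open set of \<open>Mu\<close>, whose preimage is open; complements are taken relative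
  to \<open>bounded_part\<close>, which is measurable.\<close>

lemma sets_RcapP:
  assumes \<mu>: "radon_pos betaTop \<mu>" and E: "E \<in> sets (borel_of (RMTop x0))" and i: "i \<in> {1, 2}"
  shows "RcapP x0 i E \<in> sets \<mu>"
proof -
  have "{U. openin (RMTop x0) U} \<subseteq> Pow (topspace (RMTop x0))"
    using openin_subset by blast
  then have "E \<in> sigma_sets (RM x0) {U. openin (RMTop x0) U}"
    using E by (simp add: borel_of_def sets_measure_of)
  then show ?thesis
  proof (induction E)
    case (Basic E)
    then obtain V where V: "openin MuTop V" "E = V \<inter> RM x0"
      by (auto simp: RMTop_def openin_subtopology)
    then have "RcapP x0 i E = bounded_part x0 \<inter> {\<zeta> \<in> betaM. pext i \<zeta> \<in> V}"
      using i by (auto simp: RcapP_def bounded_part_def)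
    moreover have "openin betaTop {\<zeta> \<in> betaM. pext i \<zeta> \<in> V}"
      using openin_continuous_map_preimage[OF continuous_map_pext V(1)] by simp
    ultimately show ?case
      using sets_bounded_part[OF \<mu>] sets_radon_open[OF \<mu>] by auto
  next
    case Empty
    then show ?case by (simp add: RcapP_def)
  next
    case (Compl E)
    have "RcapP x0 i (RM x0 - E) = bounded_part x0 - RcapP x0 i E"
      using i by (auto simp: RcapP_def bounded_part_def)
    then show ?case using Compl.IH sets_bounded_part[OF \<mu>] by auto
  next
    case (Union F)
    have "RcapP x0 i (\<Union>n. F n) = (\<Union>n. RcapP x0 i (F n))"
      by (auto simp: RcapP_def)
    then show ?case using Union.IH by auto
  qed
qed

text \<open>The strict inequalities say that the truncation is inactive, and they define open sets
  covering \<open>K\<close>. Stating the bound as \<open>n \<le> N\<close> avoids comparing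
  different truncation levels.\<close>

lemma compact_bounded_part:
  assumes K: "compactin betaTop K" "K \<subseteq> bounded_part x0"
  obtains N :: nat where
    "\<And>\<zeta>. \<zeta> \<in> K \<Longrightarrow> \<exists>n\<le>N. \<zeta> (tdist x0 n 1) < real n \<and> \<zeta> (tdist x0 n 2) < real n"
proof -
  let ?U = "\<lambda>n::nat. {\<zeta> \<in> betaM. \<zeta> (tdist x0 n 1) \<in> {..<real n}} \<inter>
                {\<zeta> \<in> betaM. \<zeta> (tdist x0 n 2) \<in> {..<real n}}"
  have "\<exists>\<F>. finite \<F> \<and> \<F> \<subseteq> range ?U \<and> K \<subseteq> \<Union>\<F>"
  proof (rule compactinD[OF K(1)])
    show "openin betaTop U" if "U \<in> range ?U" for U
      using that by (auto intro!: openin_Int openin_betaTop_eval tdist_Cb_til simp del: lessThan_iff)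
    show "K \<subseteq> \<Union> (range ?U)"
    proof
      fix \<zeta> assume "\<zeta> \<in> K"
      then have \<zeta>: "\<zeta> \<in> betaM" "pext 1 \<zeta> \<in> RM x0" "pext 2 \<zeta> \<in> RM x0"
        using K(2) by (auto simp: bounded_part_def)
      then obtain N1 N2 :: nat where "\<And>n. \<zeta> (tdist x0 n 1) \<le> real N1" "\<And>n. \<zeta> (tdist x0 n 2) \<le> real N2"
        by (auto simp: pext_RM_iff)
      then have "\<zeta> (tdist x0 (Suc (N1 + N2)) 1) < real (Suc (N1 + N2))"
        "\<zeta> (tdist x0 (Suc (N1 + N2)) 2) < real (Suc (N1 + N2))"
        by (smt (verit) of_nat_Suc of_nat_add of_nat_0_le_iff)+
      then show "\<zeta> \<in> \<Union> (range ?U)" using \<zeta>(1) by blast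
    qed
  qed
  then obtain \<F> where F: "finite \<F>" "\<F> \<subseteq> range ?U" "K \<subseteq> \<Union>\<F>" by blast
  then obtain I where I: "finite I" "\<F> = ?U ` I"
    by (meson finite_subset_image)
  have "\<exists>n\<le>Max I. \<zeta> (tdist x0 n 1) < real n \<and> \<zeta> (tdist x0 n 2) < real n" if "\<zeta> \<in> K" for \<zeta>
  proof -
    have "\<zeta> \<in> \<Union> (?U ` I)" using F(3) I(2) that by blast
    then obtain n where "n \<in> I" "\<zeta> \<in> ?U n" by blast
    then show ?thesis using Max_ge[OF I(1)] by (intro exI[of _ n]) auto
  qed
  with that show ?thesis by blast
qed

lemma null_outside_bounded_part:
  assumes \<mu>: "radon_pos betaTop \<mu>" and \<nu>: "radon_pos betaTop \<nu>" and prec: "preceq \<mu> \<nu>"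
    and conc: "measure \<nu> (betaM - bounded_part x0) = 0"
  shows "measure \<mu> (betaM - bounded_part x0) = 0"
proof -
  interpret \<mu>: finite_measure \<mu> using \<mu> by (simp add: radon_pos_def)
  interpret \<nu>: finite_measure \<nu> using \<nu> by (simp add: radon_pos_def)
  let ?R = "bounded_part x0"
  have "measure \<mu> (betaM - ?R) \<le> 8 * e" if e: "e > 0" for e :: real
  proof -
    obtain K where K: "compactin betaTop K" "K \<subseteq> ?R" "measure \<nu> (?R - K) < e"
      using radon_inner[OF \<nu> sets_bounded_part[OF \<nu>] e] by blast
    have Ks: "K \<in> sets \<nu>" by (rule sets_radon_compact[OF \<nu> K(1)])
    have R\<nu>: "?R \<in> sets \<nu>" "betaM - ?R \<in> sets \<nu>"
      using sets_bounded_part[OF \<nu>] sets.compl_sets[of ?R \<nu>] by (auto simp: radon_space[OF \<nu>])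
    have "measure \<nu> (betaM - K) \<le> measure \<nu> ((betaM - ?R) \<union> (?R - K))"
      using R\<nu> Ks by (intro \<nu>.finite_measure_mono) auto
    also have "\<dots> \<le> measure \<nu> (betaM - ?R) + measure \<nu> (?R - K)"
      using R\<nu> Ks by (intro measure_Un_le) auto
    finally have Ke: "measure \<nu> (betaM - K) \<le> e" using conc K(3) by simp
    obtain N :: nat where N: "\<And>\<zeta>. \<zeta> \<in> K \<Longrightarrow> \<exists>n\<le>N. \<zeta> (tdist x0 n 1) < real n \<and> \<zeta> (tdist x0 n 2) < real n"
      using compact_bounded_part[OF K(1,2)] by blast
    define h where "h x = max 0 (dist x x0 - real N)" for x
    have h: "0 \<le> h x" "\<bar>h x - h y\<bar> \<le> dist x y" for x y
      using dist_triangle[of x x0 y] dist_triangle[of y x0 x] dist_commute[of x y]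
      by (auto simp: h_def max_def)
    have s: "slope j h \<in> Cb_til" for j
      by (intro slope_Cb_til lipschitz_continuous h)
    have KM: "K \<subseteq> betaM" using K(2) by (auto simp: bounded_part_def)
    have zero: "\<zeta> (slope j h) = 0" if \<zeta>: "\<zeta> \<in> K" and j: "j \<in> {1, 2}" for \<zeta> j
    proof -
      obtain n where n: "n \<le> N" "\<zeta> (tdist x0 n j) < real n" using N[OF \<zeta>] j by auto
      \<comment> \<open>The strict inequality holds on a neighbourhood of \<open>\<zeta>\<close>; at
        its points \<open>evB q\<close> the \<open>j\<close>-th coordinate is within
        \<open>n \<le> N\<close> of \<open>x0\<close>, so \<open>h\<close> is 0 there.\<close>
      have "\<zeta> (slope j h) \<in> {0}"
      proof (rule betaM_eval_closed[of "{\<zeta> \<in> betaM. \<zeta> (tdist x0 n j) \<in> {..<real n}}" \<zeta> "slope j h"])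
        show "slope j h q \<in> {0}" if "evB q \<in> {\<zeta> \<in> betaM. \<zeta> (tdist x0 n j) \<in> {..<real n}}" for q
          using that n(1) by (auto simp: evB_apply tdist_Cb_til slope_def h_def tdist_def[of _ _ _ q])
        show "openin betaTop {\<zeta> \<in> betaM. \<zeta> (tdist x0 n j) \<in> {..<real n}}"
          by (intro openin_betaTop_eval tdist_Cb_til) auto
      qed (use n \<zeta> KM s in auto)
      then show ?thesis by simp
    qed
    \<comment> \<open>Origin of 1/4: if the larger distance \<open>a\<close> to the base point
      exceeds \<open>2 * N\<close>, then \<open>a - N > a / 2\<close>, and \<open>a\<close> is at
      least half of \<open>dist x y\<close>.\<close>
    define A where "A j = {\<zeta> \<in> betaM. \<zeta> (slope j h) \<in> {1/4..}}" for j
    have As: "A j \<in> sets \<mu>" for j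
      unfolding A_def by (intro sets_radon_eval[OF \<mu>] s) auto
    have "1/4 * measure \<mu> (A j) \<le> measure \<nu> (betaM - K)" if "j \<in> {1, 2}" for j
      by (rule preceq_slope_bound[OF \<mu> \<nu> prec h Ks _ As, where i = j]) (use zero that in \<open>auto simp: A_def\<close>)
    from this[of 1] this[of 2] Ke have Ae: "measure \<mu> (A 1) \<le> 4 * e" "measure \<mu> (A 2) \<le> 4 * e" by auto
    have "betaM - ?R \<subseteq> A 1 \<union> A 2"
    proof (rule subsetI, rule ccontr)
      fix \<zeta> assume \<zeta>: "\<zeta> \<in> betaM - ?R" "\<zeta> \<notin> A 1 \<union> A 2"
      then obtain j where "j \<in> {1, 2}" "pext j \<zeta> \<notin> RM x0" by (auto simp: bounded_part_def)
      then obtain n where n: "\<not> \<zeta> (tdist x0 n j) \<le> real (2 * N)"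
        using \<zeta>(1) pext_RM_iff[of \<zeta> j x0] by blast
      let ?U = "{\<zeta> \<in> betaM. \<zeta> (tdist x0 n j) \<in> {real (2 * N)<..}} \<inter>
         {\<zeta> \<in> betaM. \<zeta> (slope 1 h) \<in> {..<1/4}} \<inter> {\<zeta> \<in> betaM. \<zeta> (slope 2 h) \<in> {..<1/4}}"
      \<comment> \<open>The empty target set records that the open set \<open>?U\<close> contains no
        \<open>evB q\<close>, contradicting density.\<close>
      have "\<zeta> (slope 1 h) \<in> {}"
      proof (rule betaM_eval_closed[of ?U \<zeta> "slope 1 h"])
        show "openin betaTop ?U"
          by (intro openin_Int openin_betaTop_eval tdist_Cb_til s) auto
        show "\<zeta> \<in> ?U" using \<zeta> n by (auto simp: A_def)
        show "slope 1 h q \<in> {}" if q: "q \<in> Mtil" "evB q \<in> ?U" for q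
        proof -
          obtain x y where xy: "q = (x, y)" by fastforce
          have d: "dist x y > 0" "dist x y \<le> dist x x0 + dist y x0"
            using q(1) dist_triangle2[of x y x0] by (auto simp: xy Mtil_def)
          have sm: "tdist x0 n j q > 2 * real N" "slope 1 h q < 1/4" "slope 2 h q < 1/4"
            using q(2) by (auto simp: evB_apply tdist_Cb_til s)
          have "max (dist x x0) (dist y x0) > 2 * real N"
            using sm(1) by (auto simp: tdist_def xy coord_def split: if_splits)
          moreover have "h x / dist x y < 1/4" "h y / dist x y < 1/4"
            using sm(2,3) by (auto simp: slope_def xy coord_def)
          then have "4 * h x < dist x y" "4 * h y < dist x y"
            using d(1) by (auto simp: field_simps)
          ultimately show ?thesis using d(2) by (auto simp: h_def max_def split: if_splits)
        qed
      qed (use s in auto)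
      then show False by simp
    qed
    then have "measure \<mu> (betaM - ?R) \<le> measure \<mu> (A 1 \<union> A 2)"
      using As by (intro \<mu>.finite_measure_mono) auto
    also have "\<dots> \<le> measure \<mu> (A 1) + measure \<mu> (A 2)"
      using As by (intro measure_Un_le) auto
    finally show ?thesis using Ae by simp
  qed
  \<comment> \<open>With this \<open>e\<close> the bound says that the measure is at most half of
    itself.\<close>
  from this[of "measure \<mu> (betaM - ?R) / 16"] show ?thesis
    by (cases "measure \<mu> (betaM - ?R) > 0") (use measure_nonneg[of \<mu> "betaM - ?R"] in linarith)+
qed

section \<open>Points of the bounded part whose projection is far from \<open>E\<close>\<close>

text \<open>The points of \<open>\<R>\<close> whose coordinates are within \<open>N\<close> of the base point and whose \<open>i\<close>-th coordinate
  is, in the metric truncated at 1, farther than \<open>\<delta>\<close> from each \<open>p\<^sub>i(K n)\<close>; taking unions over Lipschitz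
  functions instead of using \<open>dbar\<close> makes measurability evident.\<close>

definition far_part :: "'a::metric_space \<Rightarrow> nat \<Rightarrow> (nat \<Rightarrow> (('a \<times> 'a \<Rightarrow> real) \<Rightarrow> real) set) \<Rightarrow> nat \<Rightarrow> real
    \<Rightarrow> (('a \<times> 'a \<Rightarrow> real) \<Rightarrow> real) set" where
  "far_part x0 i K N \<delta> =
    (\<Inter>n. {\<zeta> \<in> betaM. \<zeta> (tdist x0 n 1) \<in> {..real N}} \<inter> {\<zeta> \<in> betaM. \<zeta> (tdist x0 n 2) \<in> {..real N}}) \<inter>
    (\<Inter>n. \<Union>h\<in>{h \<in> Lip_unit. \<forall>\<zeta>\<in>K n. \<zeta> (\<lambda>q. h (coord i q)) = 0}. {\<xi> \<in> betaM. \<xi> (\<lambda>q. h (coord i q)) \<in> {\<delta><..}})"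

text \<open>The union over \<open>h\<close> may be uncountable, but it is a union of open sets; only
  the intersections over \<open>n\<close> have to be countable.\<close>

lemma sets_far_part:
  assumes "radon_pos betaTop \<mu>"
  shows "far_part x0 i K N \<delta> \<in> sets \<mu>"
proof -
  have "openin betaTop (\<Union>h\<in>{h \<in> Lip_unit. \<forall>\<zeta>\<in>K n. \<zeta> (\<lambda>q. h (coord i q)) = 0}.
      {\<xi> \<in> betaM. \<xi> (\<lambda>q. h (coord i q)) \<in> {\<delta><..}})" for n
    by (intro openin_Union ballI) (auto intro!: openin_betaTop_eval Ub_coord Lip_unit_Ub simp del: greaterThan_iff)
  then show ?thesis
    unfolding far_part_def
    by (intro sets.Int sets.countable_INT image_subsetI sets_radon_eval[OF assms] tdist_Cb_til
        sets_radon_open[OF assms]) auto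
qed

text \<open>On a compact \<open>L\<close> one function works at all points for a given
  \<open>n\<close>. The resulting lower bound \<open>c\<close> for the slope depends on
  \<open>\<delta>\<close> and \<open>N\<close> but not on \<open>n\<close>, so \<open>n\<close> can
  tend to infinity.\<close>

lemma null_far_part:
  assumes \<mu>: "radon_pos betaTop \<mu>" and \<nu>: "radon_pos betaTop \<nu>" and prec: "preceq \<mu> \<nu>"
    and K: "\<And>n. compactin betaTop (K n)" "\<And>n. measure \<nu> (betaM - K n) \<le> 1 / real (Suc n)"
    and \<delta>: "\<delta> > 0"
  shows "measure \<mu> (far_part x0 i K N \<delta>) = 0"
proof (rule radon_null[OF \<mu> sets_far_part[OF \<mu>]])
  fix L assume L: "compactin betaTop L" "L \<subseteq> far_part x0 i K N \<delta>"
  let ?v = "\<lambda>h q. h (coord i q) :: real"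
  \<comment> \<open>Near \<open>L\<close> the cut-off function is at least
    \<open>3 * \<delta> / 4 - \<delta> / 2\<close>, and two points within \<open>N + 1\<close> of
    \<open>x0\<close> are at most \<open>2 * N + 2\<close> apart.\<close>
  define c where "c = min 1 (\<delta> / 4 / (2 * real N + 2))"
  have c: "c > 0" using \<delta> by (simp add: c_def)
  have "c * measure \<mu> L \<le> 1 / real (Suc n)" for n
  proof -
    have KM: "K n \<subseteq> betaM" using compactin_subset_topspace[OF K(1)] by simp
    have LM: "L \<subseteq> betaM" using compactin_subset_topspace[OF L(1)] by simp
    have "\<exists>h\<in>Lip_unit. (\<forall>\<xi>\<in>L. \<xi> (?v h) \<ge> \<delta>) \<and> (\<forall>\<zeta>\<in>K n. \<zeta> (?v h) = 0)"
    proof (rule compact_positive_separation[OF L(1) KM])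
      fix \<xi> assume "\<xi> \<in> L"
      then have "\<xi> \<in> far_part x0 i K N \<delta>" using L(2) by blast
      then show "\<exists>h\<in>Lip_unit. \<xi> (?v h) > \<delta> \<and> (\<forall>\<zeta>\<in>K n. \<zeta> (?v h) = 0)"
        unfolding far_part_def by blast
    qed
    then obtain H where H: "H \<in> Lip_unit" "\<And>\<xi>. \<xi> \<in> L \<Longrightarrow> \<xi> (?v H) \<ge> \<delta>" "\<And>\<zeta>. \<zeta> \<in> K n \<Longrightarrow> \<zeta> (?v H) = 0"
      by blast
    have HC: "?v H \<in> Cb_til" by (intro Ub_coord Lip_unit_Ub H)
    \<comment> \<open>\<open>H = 0\<close> on \<open>K n\<close> is not enough for the slope to vanish there, because \<open>d(x, y)\<close> may tend to
      \<open>0\<close>; after the cutoff \<open>h\<close> vanishes on a neighbourhood.\<close>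
    define h where "h x = max 0 (H x - \<delta> / 2)" for x
    have "h \<in> Lip_unit" using Lip_unit_cutoff[OF H(1), of "\<delta> / 2"] \<delta> by (simp add: h_def[abs_def])
    then have h: "0 \<le> h x" "\<bar>h x - h y\<bar> \<le> dist x y" for x y
      by (auto simp: Lip_unit_def)
    have s: "slope i h \<in> Cb_til"
      by (intro slope_Cb_til lipschitz_continuous h)
    have zero: "\<zeta> (slope i h) = 0" if \<zeta>: "\<zeta> \<in> K n" for \<zeta>
    proof -
      have "\<zeta> (slope i h) \<in> {0}"
      proof (rule betaM_eval_closed[of "{\<zeta> \<in> betaM. \<zeta> (?v H) \<in> {..<\<delta>/2}}" \<zeta> "slope i h"])
        show "openin betaTop {\<zeta> \<in> betaM. \<zeta> (?v H) \<in> {..<\<delta>/2}}"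
          by (intro openin_betaTop_eval HC) auto
        show "\<zeta> \<in> {\<zeta> \<in> betaM. \<zeta> (?v H) \<in> {..<\<delta>/2}}"
          using H(3)[OF \<zeta>] \<zeta> KM \<delta> by auto
        show "slope i h q \<in> {0}" if "evB q \<in> {\<zeta> \<in> betaM. \<zeta> (?v H) \<in> {..<\<delta>/2}}" for q
          using that by (auto simp: evB_apply HC slope_def h_def)
      qed (use s in auto)
      then show ?thesis by simp
    qed
    have pos: "c \<le> \<xi> (slope i h)" if \<xi>: "\<xi> \<in> L" for \<xi>
    proof -
      \<comment> \<open>Weakening \<open>\<delta>\<close> to \<open>3 * \<delta> / 4\<close> and
        \<open>N\<close> to \<open>Suc N\<close> makes the conditions open while keeping
        \<open>\<xi>\<close> inside.\<close>
      let ?U = "{\<zeta> \<in> betaM. \<zeta> (?v H) \<in> {3*\<delta>/4<..}} \<inter>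
         {\<zeta> \<in> betaM. \<zeta> (tdist x0 (Suc N) 1) \<in> {..<real (Suc N)}} \<inter>
         {\<zeta> \<in> betaM. \<zeta> (tdist x0 (Suc N) 2) \<in> {..<real (Suc N)}}"
      have "\<xi> (slope i h) \<in> {c..}"
      proof (rule betaM_eval_closed[of ?U \<xi> "slope i h"])
        show "openin betaTop ?U"
          by (intro openin_Int openin_betaTop_eval tdist_Cb_til HC) auto
        have "\<xi> (tdist x0 (Suc N) 1) \<le> real N" "\<xi> (tdist x0 (Suc N) 2) \<le> real N"
          using L(2) \<xi> by (auto simp: far_part_def)
        then show "\<xi> \<in> ?U" using H(2)[OF \<xi>] \<delta> \<xi> LM by auto
        show "slope i h q \<in> {c..}" if q: "q \<in> Mtil" "evB q \<in> ?U" for q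
        proof -
          obtain x y where xy: "q = (x, y)" by fastforce
          have "tdist x0 (Suc N) 1 q < real (Suc N)" "tdist x0 (Suc N) 2 q < real (Suc N)"
            using q(2) by (auto simp: evB_apply tdist_Cb_til)
          then have "dist x x0 < real (Suc N)" "dist y x0 < real (Suc N)"
            by (auto simp: tdist_def xy coord_def)
          then have d: "dist x y > 0" "dist x y \<le> 2 * real N + 2"
            using q(1) dist_triangle2[of x y x0] by (auto simp: xy Mtil_def)
          have "H (coord i q) > 3 * \<delta> / 4" using q(2) by (auto simp: evB_apply HC)
          then have "h (coord i q) \<ge> \<delta> / 4" unfolding h_def by linarith
          then have "\<delta> / 4 / (2 * real N + 2) \<le> h (coord i q) / dist x y"
            using d \<delta> by (intro frac_le) auto
          then show ?thesis by (auto simp: slope_def c_def xy)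
        qed
      qed (use s in auto)
      then show ?thesis by simp
    qed
    have "c * measure \<mu> L \<le> measure \<nu> (betaM - K n)"
      using preceq_slope_bound[OF \<mu> \<nu> prec, of h "K n" i L c] h zero pos
        sets_radon_compact[OF \<nu> K(1)] sets_radon_compact[OF \<mu> L(1)] by blast
    then show ?thesis using K(2)[of n] by linarith
  qed
  then have "c * measure \<mu> L \<le> 0"
    using LIMSEQ_le_const[OF LIMSEQ_inverse_real_of_nat, of "c * measure \<mu> L"]
    by (auto simp: inverse_eq_divide)
  then show "measure \<mu> L = 0"
    using c measure_nonneg[of \<mu> L] by (simp add: mult_le_0_iff)
qed

text \<open>Closedness of \<open>E\<close> gives one \<open>e\<close> that separates the projection
  of \<open>\<xi>\<close> from all of \<open>E\<close>. The separation from each \<open>K n\<close>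
  is then bounded below in terms of \<open>e\<close> alone, uniformly in \<open>n\<close>.\<close>

lemma far_part_cover:
  assumes E: "E \<subseteq> RM x0" and E_closed: "\<forall>\<xi> \<in> RM x0. (\<forall>e>0. \<exists>\<eta> \<in> E. dbar x0 \<xi> \<eta> < e) \<longrightarrow> \<xi> \<in> E"
    and i: "i \<in> {1, 2}"
    and K: "\<And>n. compactin betaTop (K n)" "\<And>n. K n \<subseteq> RcapP x0 i E"
    and \<xi>: "\<xi> \<in> bounded_part x0" "\<xi> \<notin> RcapP x0 i E"
  shows "\<exists>N m. \<xi> \<in> far_part x0 i K N (1 / real (Suc m))"
proof -
  have \<xi>R: "\<xi> \<in> betaM" "pext 1 \<xi> \<in> RM x0" "pext 2 \<xi> \<in> RM x0" "pext i \<xi> \<in> RM x0" "pext i \<xi> \<notin> E"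
    using \<xi> i by (auto simp: bounded_part_def RcapP_def)
  then obtain e where e: "e > 0" "\<forall>\<eta>\<in>E. \<not> dbar x0 (pext i \<xi>) \<eta> < e"
    using E_closed by blast
  obtain N1 N2 :: nat where N12: "\<And>n. \<xi> (tdist x0 n 1) \<le> real N1" "\<And>n. \<xi> (tdist x0 n 2) \<le> real N2"
    using \<xi>R by (auto simp: pext_RM_iff)
  have N: "\<xi> (tdist x0 n 1) \<le> real (N1 + N2)" "\<xi> (tdist x0 n 2) \<le> real (N1 + N2)" for n
    using N12[of n] by auto
  define r where "r = min 1 e / 2"
  have r: "0 < r" "r \<le> 1" using e by (auto simp: r_def)
  \<comment> \<open>\<open>far_part\<close> asks for strict inequality, whereas compact separation
    gives only \<open>\<ge> r / 2\<close>.\<close>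
  obtain m where m: "1 / real (Suc m) < r / 2"
    using reals_Archimedean[of "r / 2"] r by (auto simp: inverse_eq_divide)
  have sep_K: "\<exists>h\<in>Lip_unit. \<xi> (\<lambda>q. h (coord i q)) \<ge> r / 2 \<and> (\<forall>\<zeta>\<in>K n. \<zeta> (\<lambda>q. h (coord i q)) = 0)" for n
  proof (rule compact_zero_separation[OF K(1) \<xi>R(1) r])
    fix \<zeta> assume "\<zeta> \<in> K n"
    then have "pext i \<zeta> \<in> E" using K(2) by (auto simp: RcapP_def)
    then obtain h where "h \<in> Lip_unit" "pext i \<xi> h > r" "pext i \<zeta> h = 0"
      using dbar_far_separation[OF E \<xi>R(4) e] r_def by blast
    then show "\<exists>h\<in>Lip_unit. \<xi> (\<lambda>q. h (coord i q)) > r \<and> \<zeta> (\<lambda>q. h (coord i q)) = 0"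
      by (intro bexI[of _ h]) (auto simp: pext_apply Lip_unit_Ub)
  qed
  have sep: "\<xi> \<in> (\<Union>h\<in>{h \<in> Lip_unit. \<forall>\<zeta>\<in>K n. \<zeta> (\<lambda>q. h (coord i q)) = 0}.
      {\<xi> \<in> betaM. \<xi> (\<lambda>q. h (coord i q)) \<in> {1 / real (Suc m)<..}})" for n
  proof -
    obtain h where h: "h \<in> Lip_unit" "\<xi> (\<lambda>q. h (coord i q)) \<ge> r / 2" "\<forall>\<zeta>\<in>K n. \<zeta> (\<lambda>q. h (coord i q)) = 0"
      using sep_K by blast
    show ?thesis
      by (rule UN_I[of h]) (use h m \<xi>R(1) in auto)
  qed
  have "\<xi> \<in> far_part x0 i K (N1 + N2) (1 / real (Suc m))"
    unfolding far_part_def using N \<xi>R(1) by (intro IntI INT_I sep) simp_all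
  then show ?thesis by blast
qed

section \<open>Covering the complement by countably many null sets\<close>

theorem theorem3p28:
  fixes x0 :: "'a::complete_space"
    and E :: "(('a \<Rightarrow> real) \<Rightarrow> real) set"
    and i :: nat
    and \<mu> \<nu> :: "(('a \<times> 'a \<Rightarrow> real) \<Rightarrow> real) measure"
  assumes three: "\<exists>a b c::'a. a \<noteq> b \<and> a \<noteq> c \<and> b \<noteq> c"
    and E_borel: "E \<in> sets (borel_of (RMTop x0))"
    and E_closed: "\<forall>\<xi> \<in> RM x0. (\<forall>e>0. \<exists>\<eta> \<in> E. dbar x0 \<xi> \<eta> < e) \<longrightarrow> \<xi> \<in> E"
    and i: "i \<in> {1, 2}"
    and \<mu>: "radon_pos betaTop \<mu>"
    and \<nu>: "radon_pos betaTop \<nu>"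
    and prec: "preceq \<mu> \<nu>"
    and conc: "concentrated_on \<nu> (RcapP x0 i E)"
  shows "concentrated_on \<mu> (RcapP x0 i E)"
proof -
  interpret \<mu>: finite_measure \<mu> using \<mu> by (simp add: radon_pos_def)
  interpret \<nu>: finite_measure \<nu> using \<nu> by (simp add: radon_pos_def)
  let ?B = "RcapP x0 i E" and ?R = "bounded_part x0"
  have BR: "?B \<subseteq> ?R" by (auto simp: RcapP_def bounded_part_def)
  have E: "E \<subseteq> RM x0"
    using sets.sets_into_space[OF E_borel] by (simp add: borel_of_def space_measure_of_conv)
  have B\<nu>: "?B \<in> sets \<nu>" "betaM - ?B \<in> sets \<nu>"
    using sets_RcapP[OF \<nu> E_borel i] sets.compl_sets[of ?B \<nu>] by (auto simp: radon_space[OF \<nu>])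
  have R\<mu>: "betaM - ?R \<in> sets \<mu>"
    using sets_bounded_part[OF \<mu>] sets.compl_sets[of ?R \<mu>] by (auto simp: radon_space[OF \<mu>])
  have \<nu>B: "measure \<nu> (betaM - ?B) = 0"
    using conc by (simp add: concentrated_on_def radon_space[OF \<nu>] \<nu>.emeasure_eq_measure)
  \<comment> \<open>\<open>\<nu>\<close> is also concentrated on the larger set \<open>?R\<close>,
    so the first null set is the complement of \<open>?R\<close>.\<close>
  have "measure \<nu> (betaM - ?R) \<le> measure \<nu> (betaM - ?B)"
    using B\<nu> BR by (intro \<nu>.finite_measure_mono) auto
  then have "measure \<mu> (betaM - ?R) = 0"
    using \<nu>B measure_nonneg[of \<nu> "betaM - ?R"] by (intro null_outside_bounded_part[OF \<mu> \<nu> prec]) linarith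
  then have nullR: "betaM - ?R \<in> null_sets \<mu>"
    using R\<mu> by (auto simp: null_sets_def \<mu>.emeasure_eq_measure)
  have "\<exists>K. compactin betaTop K \<and> K \<subseteq> ?B \<and> measure \<nu> (?B - K) < 1 / real (Suc n)" for n
    by (rule radon_inner[OF \<nu> B\<nu>(1)]) simp
  then obtain K where K: "\<And>n. compactin betaTop (K n)" "\<And>n. K n \<subseteq> ?B"
    "\<And>n. measure \<nu> (?B - K n) < 1 / real (Suc n)" by metis
  have K\<nu>: "measure \<nu> (betaM - K n) \<le> 1 / real (Suc n)" for n
  proof -
    have Ks: "K n \<in> sets \<nu>" by (rule sets_radon_compact[OF \<nu> K(1)])
    have "measure \<nu> (betaM - K n) \<le> measure \<nu> ((betaM - ?B) \<union> (?B - K n))"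
      using B\<nu> Ks by (intro \<nu>.finite_measure_mono) auto
    also have "\<dots> \<le> measure \<nu> (betaM - ?B) + measure \<nu> (?B - K n)"
      using B\<nu> Ks by (intro measure_Un_le) auto
    finally show ?thesis using \<nu>B K(3)[of n] by simp
  qed
  have null: "far_part x0 i K N (1 / real (Suc m)) \<in> null_sets \<mu>" for N m
    using null_far_part[OF \<mu> \<nu> prec K(1) K\<nu>, of "1 / real (Suc m)" x0 i N] sets_far_part[OF \<mu>, of x0 i K N]
    by (auto simp: null_sets_def \<mu>.emeasure_eq_measure)
  have "(betaM - ?R) \<union> (\<Union>N. \<Union>m. far_part x0 i K N (1 / real (Suc m))) \<in> null_sets \<mu>"
    by (intro null_sets.Un null_sets_UN null nullR)
  moreover have "betaM - ?B \<subseteq> (betaM - ?R) \<union> (\<Union>N. \<Union>m. far_part x0 i K N (1 / real (Suc m)))"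
  proof
    fix \<xi> assume "\<xi> \<in> betaM - ?B"
    then show "\<xi> \<in> (betaM - ?R) \<union> (\<Union>N. \<Union>m. far_part x0 i K N (1 / real (Suc m)))"
      using far_part_cover[OF E E_closed i K(1,2), of \<xi>] by (cases "\<xi> \<in> ?R") auto
  qed
  \<comment> \<open>\<open>\<mu>\<close> need not be complete, so a subset of a null set is null
    only once it is known to be measurable.\<close>
  moreover have "betaM - ?B \<in> sets \<mu>"
    using sets_RcapP[OF \<mu> E_borel i] sets.compl_sets[of ?B \<mu>] by (auto simp: radon_space[OF \<mu>])
  ultimately have "betaM - ?B \<in> null_sets \<mu>"
    using null_sets_subset by blast
  then show ?thesis
    by (simp add: concentrated_on_def radon_space[OF \<mu>] null_sets_def)
qed

end
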